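(* Under the transformation $$V(y,t)=v(z,t)-\beta,\qquad y=z-2\beta t,\qquad t>0$$ (with corresponding free boundaries $y_0(t)=z_0(t)-2\beta t$, $y_1(t)=z_1(t)-2\beta t$), the free boundary problem $$v_t=Dv_{zz}-2vv_z,\quad z_0(t)<z<z_1(t),\ t>0,$$ $$v(z_0(t),t)=f(t),\quad v(z_1(t),t)=\beta,\quad D\frac{v_z(z_1(t),t)}{v(z_1(t),t)}-v(z_1(t),t)=-\frac{\beta}{\beta+1}\dot z_1(t),\quad t>0,$$ $$v(z,0)=v_0(z),\ C_1\le z\le C_2,\qquad z_0(0)=C_1,\ z_1(0)=C_2,$$ $$z_0(t)=C_1+\int_0^t\Big(f(\tau)-D\frac{v_z(z_0(\tau),\tau)}{f(\tau)}\Big)d\tau,\qquad z_1(t)=C_2+(\beta+1)t-\frac{D(\beta+1)}{\beta^2}\int_0^t v_z(z_1(\tau),\tau)d\tau$$ is equivalent to the free boundary problem $$V_t=DV_{yy}-2VV_y,\quad y_0(t)<y<y_1(t),\ t>0,$$ $$V(y_0(t),t)=f(t)-\beta,\qquad V(y_1(t),t)=0,\qquad D\frac{V_y(y_1(t),t)}{\beta}=\frac{\beta(1-\beta)-\beta\dot y_1(t)}{\beta+1},\quad t>0,$$ $$V(y,0)=V_0(y),\ C_1\le y\le C_2,\qquad y_0(0)=C_1,\ y_1(0)=C_2,$$ where $V_0(y)=v_0(y)-\beta$ and $$y_0(t)=C_1-2\beta t+\int_0^t\Big(f(\tau)-D\frac{V_y(y_0(\tau),\tau)}{f(\tau)}\Big)d\tau,$$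 $$y_1(t)=C_2+(1-\beta)t-\frac{D(\beta+1)}{\beta^2}\int_0^tV_y(y_1(\tau),\tau)d\tau .$$
   Context: $D>0$, $\beta>0$, $b>0$, $\sigma>0$ are constants. The data satisfy: $f\in C^1[0,\sigma]$, $u_0\in C^1[0,b]$, $u_0(0)=f(0)$, $u_0(b)=\beta$, $u_0(x)>\beta$ for $0\le x<b$, and $f(t)>\frac{3\beta}{2}$. $C_1$ is an arbitrary constant, $U_0=\int_0^b\frac{d\eta}{u_0(\eta)}$, $C_2=C_1+U_0$, $g(x)=C_1+\int_0^x\frac{d\eta}{u_0(\eta)}$ and $v_0(z)=u_0(g^{-1}(z))$ for $C_1\le z\le C_2$. Solutions are understood in the classical sense; conditions "for $t>0$" are understood on the time interval where $f$ is given. A dot denotes differentiation in $t$. *)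

theory Defs
  imports "HOL-Analysis.Analysis"
begin

text \<open>
  Derivatives are taken within the set \<open>S\<close>, hence are one-sided at its end points;
  the library's \<open>C1_differentiable_on\<close> would ask for two-sided ones.
\<close>

definition has_cont_deriv_on :: "(real \<Rightarrow> real) \<Rightarrow> (real \<Rightarrow> real) \<Rightarrow> real set \<Rightarrow> bool" where
  "has_cont_deriv_on h h' S \<longleftrightarrow>
     (\<forall>x\<in>S. (h has_real_derivative h' x) (at x within S)) \<and> continuous_on S h'"

definition C1_on :: "real set \<Rightarrow> (real \<Rightarrow> real) \<Rightarrow> bool" where
  "C1_on S h \<longleftrightarrow> (\<exists>h'. has_cont_deriv_on h h' S)"

text \<open>
  What it means for \<open>w\<close> with moving boundaries \<open>s0\<close>, \<open>s1\<close> to be a candidate for a classical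
  solution on the time interval \<open>[0, \<sigma>]\<close>, with \<open>ds1\<close> the time derivative of \<open>s1\<close> and
  \<open>wx\<close>, \<open>wxx\<close>, \<open>wt\<close> the partial derivatives of \<open>w\<close>.
  Conditions ``for t > 0'' range over \<open>0 < t \<le> \<sigma>\<close>.
  Only values on the closed moving domain \<open>s0 t \<le> x \<le> s1 t\<close>, \<open>0 \<le> t \<le> \<sigma>\<close>, matter: the space
  derivative at a moving boundary and the time derivative at \<open>t = \<sigma>\<close> are one-sided.
  The function \<open>wx\<close> is not required to be continuous up to \<open>t = 0\<close>, so the integrals of its
  boundary values are possibly improper at \<open>0\<close> and their convergence is demanded.
\<close>

definition classical_regularity ::
  "real \<Rightarrow> (real \<Rightarrow> real) \<Rightarrow> (real \<Rightarrow> real) \<Rightarrow> (real \<Rightarrow> real) \<Rightarrow> (real \<Rightarrow> real \<Rightarrow> real) \<Rightarrow>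
   (real \<Rightarrow> real \<Rightarrow> real) \<Rightarrow> (real \<Rightarrow> real \<Rightarrow> real) \<Rightarrow> (real \<Rightarrow> real \<Rightarrow> real) \<Rightarrow> bool" where
  "classical_regularity \<sigma> s0 s1 ds1 w wx wxx wt \<longleftrightarrow>
     continuous_on {0..\<sigma>} s0 \<and> continuous_on {0..\<sigma>} s1 \<and>
     C1_on {0<..\<sigma>} s0 \<and> has_cont_deriv_on s1 ds1 {0<..\<sigma>} \<and>
     (\<forall>t\<in>{0..\<sigma>}. s0 t < s1 t) \<and>
     continuous_on {(x, t). 0 \<le> t \<and> t \<le> \<sigma> \<and> s0 t \<le> x \<and> x \<le> s1 t} (\<lambda>(x, t). w x t) \<and>
     continuous_on {(x, t). 0 < t \<and> t \<le> \<sigma> \<and> s0 t \<le> x \<and> x \<le> s1 t} (\<lambda>(x, t). wx x t) \<and>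
     continuous_on {(x, t). 0 < t \<and> t \<le> \<sigma> \<and> s0 t < x \<and> x < s1 t} (\<lambda>(x, t). wxx x t) \<and>
     continuous_on {(x, t). 0 < t \<and> t \<le> \<sigma> \<and> s0 t < x \<and> x < s1 t} (\<lambda>(x, t). wt x t) \<and>
     (\<forall>t\<in>{0<..\<sigma>}. \<forall>x\<in>{s0 t..s1 t}.
        ((\<lambda>\<xi>. w \<xi> t) has_real_derivative wx x t) (at x within {s0 t..s1 t})) \<and>
     (\<forall>t\<in>{0<..\<sigma>}. \<forall>x\<in>{s0 t<..<s1 t}.
        ((\<lambda>\<xi>. wx \<xi> t) has_real_derivative wxx x t) (at x) \<and>
        ((\<lambda>\<tau>. w x \<tau>) has_real_derivative wt x t)
           (at t within {\<tau>\<in>{0..\<sigma>}. s0 \<tau> \<le> x \<and> x \<le> s1 \<tau>})) \<and>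
     (\<lambda>\<tau>. wx (s0 \<tau>) \<tau>) integrable_on {0..\<sigma>} \<and>
     (\<lambda>\<tau>. wx (s1 \<tau>) \<tau>) integrable_on {0..\<sigma>}"

definition solves_fbp_v ::
  "real \<Rightarrow> real \<Rightarrow> real \<Rightarrow> (real \<Rightarrow> real) \<Rightarrow> real \<Rightarrow> real \<Rightarrow> (real \<Rightarrow> real) \<Rightarrow>
   (real \<Rightarrow> real \<Rightarrow> real) \<Rightarrow> (real \<Rightarrow> real) \<Rightarrow> (real \<Rightarrow> real) \<Rightarrow> bool" where
  "solves_fbp_v D \<beta> \<sigma> f C1 C2 v0 v z0 z1 \<longleftrightarrow>
     (\<exists>dz1 vz vzz vt.
        classical_regularity \<sigma> z0 z1 dz1 v vz vzz vt \<and>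
        (\<forall>t\<in>{0<..\<sigma>}. \<forall>z\<in>{z0 t<..<z1 t}. vt z t = D * vzz z t - 2 * v z t * vz z t) \<and>
        (\<forall>t\<in>{0<..\<sigma>}. v (z0 t) t = f t) \<and>
        (\<forall>t\<in>{0<..\<sigma>}. v (z1 t) t = \<beta>) \<and>
        (\<forall>t\<in>{0<..\<sigma>}. D * (vz (z1 t) t / v (z1 t) t) - v (z1 t) t = - (\<beta> / (\<beta> + 1)) * dz1 t) \<and>
        (\<forall>z\<in>{C1..C2}. v z 0 = v0 z) \<and>
        z0 0 = C1 \<and> z1 0 = C2 \<and>
        (\<forall>t\<in>{0..\<sigma>}. z0 t = C1 + integral {0..t} (\<lambda>\<tau>. f \<tau> - D * (vz (z0 \<tau>) \<tau> / f \<tau>))) \<and>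
        (\<forall>t\<in>{0..\<sigma>}. z1 t = C2 + (\<beta> + 1) * t
            - D * (\<beta> + 1) / \<beta>\<^sup>2 * integral {0..t} (\<lambda>\<tau>. vz (z1 \<tau>) \<tau>)))"

definition solves_fbp_V ::
  "real \<Rightarrow> real \<Rightarrow> real \<Rightarrow> (real \<Rightarrow> real) \<Rightarrow> real \<Rightarrow> real \<Rightarrow> (real \<Rightarrow> real) \<Rightarrow>
   (real \<Rightarrow> real \<Rightarrow> real) \<Rightarrow> (real \<Rightarrow> real) \<Rightarrow> (real \<Rightarrow> real) \<Rightarrow> bool" where
  "solves_fbp_V D \<beta> \<sigma> f C1 C2 V0 V y0 y1 \<longleftrightarrow>
     (\<exists>dy1 Vy Vyy Vt.
        classical_regularity \<sigma> y0 y1 dy1 V Vy Vyy Vt \<and>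
        (\<forall>t\<in>{0<..\<sigma>}. \<forall>y\<in>{y0 t<..<y1 t}. Vt y t = D * Vyy y t - 2 * V y t * Vy y t) \<and>
        (\<forall>t\<in>{0<..\<sigma>}. V (y0 t) t = f t - \<beta>) \<and>
        (\<forall>t\<in>{0<..\<sigma>}. V (y1 t) t = 0) \<and>
        (\<forall>t\<in>{0<..\<sigma>}. D * (Vy (y1 t) t / \<beta>) = (\<beta> * (1 - \<beta>) - \<beta> * dy1 t) / (\<beta> + 1)) \<and>
        (\<forall>y\<in>{C1..C2}. V y 0 = V0 y) \<and>
        y0 0 = C1 \<and> y1 0 = C2 \<and>
        (\<forall>t\<in>{0..\<sigma>}. y0 t = C1 - 2 * \<beta> * t
            + integral {0..t} (\<lambda>\<tau>. f \<tau> - D * (Vy (y0 \<tau>) \<tau> / f \<tau>))) \<and>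
        (\<forall>t\<in>{0..\<sigma>}. y1 t = C2 + (1 - \<beta>) * t
            - D * (\<beta> + 1) / \<beta>\<^sup>2 * integral {0..t} (\<lambda>\<tau>. Vy (y1 \<tau>) \<tau>)))"

end

theory Submission
  imports Defs
begin

text \<open>
  The map \<open>y = z - 2 \<beta> t\<close> passes to a frame moving with speed \<open>2 \<beta>\<close>, and \<open>V = v - \<beta>\<close> lowers the
  unknown by a constant. Space derivatives are carried along unchanged, whereas the chain rule
  gives \<open>V\<^sub>t = v\<^sub>t + 2 \<beta> v\<^sub>z\<close>. Since \<open>v = V + \<beta>\<close>, the equation \<open>v\<^sub>t = D v\<^sub>z\<^sub>z - 2 v v\<^sub>z\<close> becomes
  \<open>V\<^sub>t = D V\<^sub>y\<^sub>y - 2 (V + \<beta>) V\<^sub>y + 2 \<beta> V\<^sub>y = D V\<^sub>y\<^sub>y - 2 V V\<^sub>y\<close>: the speed \<open>2 \<beta>\<close> is exactly the one for which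
  the transport terms coming from the two substitutions cancel. The boundary conditions match
  through \<open>z1' = y1' + 2 \<beta>\<close> by algebra.

  The analytic content is that classical regularity survives the change of frame. The one
  delicate point is the time derivative, because a line of constant \<open>y\<close> is slanted in the
  \<open>(z, t)\<close> plane: it is obtained from total differentiability of \<open>v\<close>, which follows from the
  existence of \<open>v\<^sub>t\<close> and the continuity of \<open>v\<^sub>z\<close>. This is the lemma
  \<open>has_real_derivative_along_slanted_line\<close>; \<open>classical_regularity_moving_frame\<close> collects the
  transfer of all other conditions. The frame change is stated for an arbitrary speed and shift,
  so that the same lemma, used with opposite signs, also carries solutions back.
\<close>

section \<open>Differentiation in time inside a moving domain\<close>

text \<open>
  A point strictly between the moving boundaries stays between them for nearby times, so the
  restriction of the time set to the moving domain does not affect derivatives there. The bound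
  \<open>d \<le> t\<close> keeps these times positive: at time \<open>0\<close> nothing is known about the space derivative.
\<close>

lemma interior_of_moving_domain_nhd:
  fixes s0 s1 :: "real \<Rightarrow> real"
  assumes "continuous_on {0..\<sigma>} s0" "continuous_on {0..\<sigma>} s1"
    and "0 < t" "t \<le> \<sigma>" "s0 t < x" "x < s1 t"
  obtains d a b where "0 < d" "d \<le> t" "a < x" "x < b"
    and "\<And>\<tau>. \<tau> \<in> {0..\<sigma>} \<Longrightarrow> \<bar>\<tau> - t\<bar> < d \<Longrightarrow> s0 \<tau> < a \<and> b < s1 \<tau>"
proof -
  define a b where "a = (s0 t + x) / 2" and "b = (x + s1 t) / 2"
  have ab: "s0 t < a" "a < x" "x < b" "b < s1 t"
    using assms unfolding a_def b_def by auto
  have "(s0 \<longlongrightarrow> s0 t) (at t within {0..\<sigma>})" "(s1 \<longlongrightarrow> s1 t) (at t within {0..\<sigma>})"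
    using assms by (auto simp: continuous_on_def)
  then have "\<forall>\<^sub>F \<tau> in at t within {0..\<sigma>}. s0 \<tau> < a \<and> b < s1 \<tau>"
    using ab by (intro eventually_conj order_tendstoD)
  then obtain d where "0 < d"
    and d: "\<And>\<tau>. \<tau> \<in> {0..\<sigma>} \<Longrightarrow> \<tau> \<noteq> t \<Longrightarrow> \<bar>\<tau> - t\<bar> < d \<Longrightarrow> s0 \<tau> < a \<and> b < s1 \<tau>"
    by (auto simp: eventually_at dist_real_def)
  show thesis
  proof (rule that[of "min d t" a b])
    fix \<tau> assume "\<tau> \<in> {0..\<sigma>}" "\<bar>\<tau> - t\<bar> < min d t"
    then show "s0 \<tau> < a \<and> b < s1 \<tau>"
      using d[of \<tau>] ab by (cases "\<tau> = t") auto
  qed (use \<open>0 < d\<close> assms ab in auto)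
qed

lemma at_within_moving_domain_times:
  fixes s0 s1 :: "real \<Rightarrow> real"
  assumes "continuous_on {0..\<sigma>} s0" "continuous_on {0..\<sigma>} s1"
    and "0 < t" "t \<le> \<sigma>" "s0 t < x" "x < s1 t"
  shows "at t within {\<tau>\<in>{0..\<sigma>}. s0 \<tau> \<le> x \<and> x \<le> s1 \<tau>} = at t within {0..\<sigma>}"
proof -
  obtain d a b where d: "0 < d" "d \<le> t" "a < x" "x < b"
    and nhd: "\<And>\<tau>. \<tau> \<in> {0..\<sigma>} \<Longrightarrow> \<bar>\<tau> - t\<bar> < d \<Longrightarrow> s0 \<tau> < a \<and> b < s1 \<tau>"
    using interior_of_moving_domain_nhd[OF assms] by metis
  show ?thesis
  proof (rule at_within_nhd[of t "ball t d"])
    show "{\<tau>\<in>{0..\<sigma>}. s0 \<tau> \<le> x \<and> x \<le> s1 \<tau>} \<inter> ball t d - {t} = {0..\<sigma>} \<inter> ball t d - {t}"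
      using nhd d by (force simp: dist_real_def abs_minus_commute)
  qed (use d in auto)
qed

text \<open>
  Existence of one partial derivative at the point and continuity of the other one around it give
  total differentiability, hence a derivative along every line through the point. Near the point
  the domain contains a product of time and space intervals, which is relatively open in time
  when \<open>t = \<sigma>\<close>.
\<close>

lemma has_real_derivative_along_slanted_line:
  fixes w wx :: "real \<Rightarrow> real \<Rightarrow> real"
  assumes s: "continuous_on {0..\<sigma>} s0" "continuous_on {0..\<sigma>} s1"
    and wx_cont: "continuous_on {(x, t). 0 < t \<and> t \<le> \<sigma> \<and> s0 t \<le> x \<and> x \<le> s1 t} (\<lambda>(x, t). wx x t)"
    and wx: "\<And>t x. t \<in> {0<..\<sigma>} \<Longrightarrow> x \<in> {s0 t..s1 t} \<Longrightarrow>
      ((\<lambda>\<xi>. w \<xi> t) has_real_derivative wx x t) (at x within {s0 t..s1 t})"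
    and t: "0 < t" "t \<le> \<sigma>" and y: "s0 t < y + c * t" "y + c * t < s1 t"
    and wt: "((\<lambda>\<tau>. w (y + c * t) \<tau>) has_real_derivative w') (at t within {0..\<sigma>})"
  shows "((\<lambda>\<tau>. w (y + c * \<tau>) \<tau>) has_real_derivative w' + c * wx (y + c * t) t)
    (at t within {0..\<sigma>})"
proof -
  define x where "x = y + c * t"
  obtain d a b where d: "0 < d" "d \<le> t" "a < x" "x < b"
    and nhd: "\<And>\<tau>. \<tau> \<in> {0..\<sigma>} \<Longrightarrow> \<bar>\<tau> - t\<bar> < d \<Longrightarrow> s0 \<tau> < a \<and> b < s1 \<tau>"
    using interior_of_moving_domain_nhd[OF s t y] unfolding x_def by metis
  define T where "T = {0..\<sigma>} \<inter> ball t d"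
  define Y where "Y = {a<..<b}"
  have box: "0 < \<tau> \<and> \<tau> \<le> \<sigma> \<and> s0 \<tau> < \<xi> \<and> \<xi> < s1 \<tau>" if "\<tau> \<in> T" "\<xi> \<in> Y" for \<tau> \<xi>
  proof -
    have "\<tau> \<in> {0..\<sigma>}" "\<bar>\<tau> - t\<bar> < d" "a < \<xi>" "\<xi> < b"
      using that unfolding T_def Y_def by (auto simp: dist_real_def)
    then show ?thesis
      using nhd[of \<tau>] d by auto
  qed
  have tT: "t \<in> T" and xY: "x \<in> Y"
    using d t unfolding T_def Y_def by auto
  have total: "((\<lambda>(\<tau>, \<xi>). w \<xi> \<tau>) has_derivative
      (\<lambda>(h, k). w' * h + blinfun_apply (wx x t *\<^sub>R id_blinfun) k)) (at (t, x) within T \<times> Y)"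
  proof (rule has_derivative_partialsI)
    show "((\<lambda>\<tau>. w x \<tau>) has_derivative (\<lambda>h. w' * h)) (at t within T)"
      using wt has_derivative_subset[of _ _ t "{0..\<sigma>}" T]
      unfolding x_def T_def has_field_derivative_def by blast
  next
    fix \<tau> \<xi> assume *: "\<tau> \<in> T" "\<xi> \<in> Y"
    have "((\<lambda>\<xi>. w \<xi> \<tau>) has_real_derivative wx \<xi> \<tau>) (at \<xi> within {s0 \<tau>..s1 \<tau>})"
      using box[OF *] by (intro wx) auto
    then have "((\<lambda>\<xi>. w \<xi> \<tau>) has_real_derivative wx \<xi> \<tau>) (at \<xi> within Y)"
      by (rule has_field_derivative_subset) (auto dest!: box[OF *(1)])
    then show "((\<lambda>\<xi>. w \<xi> \<tau>) has_derivative blinfun_apply (wx \<xi> \<tau> *\<^sub>R id_blinfun)) (at \<xi> within Y)"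
      by (simp add: has_field_derivative_def scaleR_blinfun.rep_eq id_blinfun.rep_eq)
  next
    have "continuous_on (T \<times> Y) (\<lambda>p. (\<lambda>(x, t). wx x t) (snd p, fst p))"
      by (rule continuous_on_compose2[OF wx_cont])
        (auto intro!: continuous_intros dest: box)
    then have "continuous_on (T \<times> Y) (\<lambda>(\<tau>, \<xi>). wx \<xi> \<tau> *\<^sub>R (id_blinfun :: real \<Rightarrow>\<^sub>L real))"
      by (auto simp: case_prod_unfold intro!: continuous_intros)
    then show "continuous (at (t, x) within T \<times> Y)
        (\<lambda>(\<tau>, \<xi>). wx \<xi> \<tau> *\<^sub>R (id_blinfun :: real \<Rightarrow>\<^sub>L real))"
      using tT xY by (simp add: continuous_on_eq_continuous_within)
  qed (use xY in \<open>auto simp: Y_def\<close>)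
  \<comment> \<open>The times at which the slanted line has not yet left the product neighbourhood.\<close>
  define S where "S = {\<tau>\<in>T. y + c * \<tau> \<in> Y}"
  have "((\<lambda>\<tau>. (\<tau>, y + c * \<tau>)) has_derivative (\<lambda>h. (h, c * h))) (at t within S)"
    by (auto intro!: derivative_eq_intros)
  moreover have "((\<lambda>(\<tau>, \<xi>). w \<xi> \<tau>) has_derivative
      (\<lambda>(h, k). w' * h + blinfun_apply (wx x t *\<^sub>R id_blinfun) k))
      (at (t, y + c * t) within (\<lambda>\<tau>. (\<tau>, y + c * \<tau>)) ` S)"
    using total unfolding x_def
    by (rule has_derivative_subset) (auto simp: S_def)
  ultimately have "((\<lambda>\<tau>. w (y + c * \<tau>) \<tau>) has_derivative (\<lambda>h. w' * h + wx x t * (c * h)))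
      (at t within S)"
    using has_derivative_in_compose[of "\<lambda>\<tau>. (\<tau>, y + c * \<tau>)" _ t S]
    by (fastforce simp: scaleR_blinfun.rep_eq id_blinfun.rep_eq)
  then have "((\<lambda>\<tau>. w (y + c * \<tau>) \<tau>) has_real_derivative w' + c * wx x t) (at t within S)"
    by (rule has_derivative_imp_has_field_derivative) (simp add: algebra_simps)
  moreover have "at t within S = at t within {0..\<sigma>}"
  proof (rule at_within_nhd)
    show "open (ball t d \<inter> (\<lambda>\<tau>. y + c * \<tau>) -` Y)"
      unfolding Y_def by (intro open_Int open_ball open_vimage open_greaterThanLessThan continuous_intros)
    show "t \<in> ball t d \<inter> (\<lambda>\<tau>. y + c * \<tau>) -` Y"
      using d xY by (auto simp: x_def)
  qed (auto simp: S_def T_def)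
  ultimately show ?thesis
    by (simp add: x_def)
qed

section \<open>Classical regularity in a moving frame\<close>

text \<open>
  The substitution \<open>x = y + c t\<close> is a homeomorphism of the closed moving domains that preserves
  time slices, so continuity, space derivatives and boundary integrals are transported by
  composition. Only the time derivative changes its form: it acquires the transport term
  \<open>c w\<^sub>x\<close>.
\<close>

lemma classical_regularity_moving_frame:
  assumes reg: "classical_regularity \<sigma> s0 s1 ds1 w wx wxx wt"
    and r0: "\<And>t. t \<in> {0..\<sigma>} \<Longrightarrow> r0 t = s0 t - c * t"
    and r1: "\<And>t. t \<in> {0..\<sigma>} \<Longrightarrow> r1 t = s1 t - c * t"
    and u: "\<And>y t. t \<in> {0..\<sigma>} \<Longrightarrow> y \<in> {r0 t..r1 t} \<Longrightarrow> u y t = w (y + c * t) t - k"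
  shows "classical_regularity \<sigma> r0 r1 (\<lambda>t. ds1 t - c) u
    (\<lambda>y t. wx (y + c * t) t) (\<lambda>y t. wxx (y + c * t) t)
    (\<lambda>y t. wt (y + c * t) t + c * wx (y + c * t) t)"
proof -
  have s: "continuous_on {0..\<sigma>} s0" "continuous_on {0..\<sigma>} s1"
    and s0_C1: "C1_on {0<..\<sigma>} s0" and s1_C1: "has_cont_deriv_on s1 ds1 {0<..\<sigma>}"
    and s_less: "\<And>t. t \<in> {0..\<sigma>} \<Longrightarrow> s0 t < s1 t"
    and w_cont: "continuous_on {(x, t). 0 \<le> t \<and> t \<le> \<sigma> \<and> s0 t \<le> x \<and> x \<le> s1 t} (\<lambda>(x, t). w x t)"
    and wx_cont: "continuous_on {(x, t). 0 < t \<and> t \<le> \<sigma> \<and> s0 t \<le> x \<and> x \<le> s1 t} (\<lambda>(x, t). wx x t)"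
    and wxx_cont: "continuous_on {(x, t). 0 < t \<and> t \<le> \<sigma> \<and> s0 t < x \<and> x < s1 t} (\<lambda>(x, t). wxx x t)"
    and wt_cont: "continuous_on {(x, t). 0 < t \<and> t \<le> \<sigma> \<and> s0 t < x \<and> x < s1 t} (\<lambda>(x, t). wt x t)"
    and wx: "\<And>t x. t \<in> {0<..\<sigma>} \<Longrightarrow> x \<in> {s0 t..s1 t} \<Longrightarrow>
      ((\<lambda>\<xi>. w \<xi> t) has_real_derivative wx x t) (at x within {s0 t..s1 t})"
    and wxx: "\<And>t x. t \<in> {0<..\<sigma>} \<Longrightarrow> x \<in> {s0 t<..<s1 t} \<Longrightarrow>
      ((\<lambda>\<xi>. wx \<xi> t) has_real_derivative wxx x t) (at x)"
    and wt: "\<And>t x. t \<in> {0<..\<sigma>} \<Longrightarrow> x \<in> {s0 t<..<s1 t} \<Longrightarrow>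
      ((\<lambda>\<tau>. w x \<tau>) has_real_derivative wt x t)
        (at t within {\<tau>\<in>{0..\<sigma>}. s0 \<tau> \<le> x \<and> x \<le> s1 \<tau>})"
    and int0: "(\<lambda>\<tau>. wx (s0 \<tau>) \<tau>) integrable_on {0..\<sigma>}"
    and int1: "(\<lambda>\<tau>. wx (s1 \<tau>) \<tau>) integrable_on {0..\<sigma>}"
    using reg unfolding classical_regularity_def by blast+
  have r: "continuous_on {0..\<sigma>} r0" "continuous_on {0..\<sigma>} r1"
  proof -
    show "continuous_on {0..\<sigma>} r0"
      by (rule continuous_on_eq[of _ "\<lambda>t. s0 t - c * t"])
        (use s r0 in \<open>auto intro!: continuous_intros\<close>)
    show "continuous_on {0..\<sigma>} r1"
      by (rule continuous_on_eq[of _ "\<lambda>t. s1 t - c * t"])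
        (use s r1 in \<open>auto intro!: continuous_intros\<close>)
  qed
  have shift_deriv: "has_cont_deriv_on q (\<lambda>t. h t - c) {0<..\<sigma>}"
    if "has_cont_deriv_on p h {0<..\<sigma>}" "\<And>t. t \<in> {0..\<sigma>} \<Longrightarrow> q t = p t - c * t" for p q h
    unfolding has_cont_deriv_on_def
  proof (intro conjI ballI)
    fix t assume t: "t \<in> {0<..\<sigma>}"
    have "((\<lambda>t. p t - c * t) has_real_derivative h t - c) (at t within {0<..\<sigma>})"
      using that(1) t unfolding has_cont_deriv_on_def
      by (auto intro!: derivative_eq_intros)
    then show "(q has_real_derivative h t - c) (at t within {0<..\<sigma>})"
      by (rule has_field_derivative_transform_within[OF _ zero_less_one]) (use t that(2) in auto)
  qed (use that(1) in \<open>auto simp: has_cont_deriv_on_def intro!: continuous_intros\<close>)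
  have "C1_on {0<..\<sigma>} r0"
    using s0_C1 shift_deriv r0 unfolding C1_on_def by blast
  moreover have "has_cont_deriv_on r1 (\<lambda>t. ds1 t - c) {0<..\<sigma>}"
    using shift_deriv s1_C1 r1 by blast
  moreover have "\<forall>t\<in>{0..\<sigma>}. r0 t < r1 t"
    using s_less r0 r1 by auto
  moreover have "continuous_on {(y, t). 0 \<le> t \<and> t \<le> \<sigma> \<and> r0 t \<le> y \<and> y \<le> r1 t} (\<lambda>(y, t). u y t)"
  proof -
    have "continuous_on {(y, t). 0 \<le> t \<and> t \<le> \<sigma> \<and> r0 t \<le> y \<and> y \<le> r1 t}
        (\<lambda>p. (\<lambda>(x, t). w x t) (fst p + c * snd p, snd p) - k)"
      by (intro continuous_intros continuous_on_compose2[OF w_cont]) (auto simp: r0 r1)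
    then show ?thesis
      by (rule continuous_on_eq) (auto simp: u)
  qed
  moreover have wx_frame: "continuous_on {(y, t). 0 < t \<and> t \<le> \<sigma> \<and> r0 t \<le> y \<and> y \<le> r1 t}
      (\<lambda>(y, t). wx (y + c * t) t)"
  proof -
    have "continuous_on {(y, t). 0 < t \<and> t \<le> \<sigma> \<and> r0 t \<le> y \<and> y \<le> r1 t}
        (\<lambda>p. (\<lambda>(x, t). wx x t) (fst p + c * snd p, snd p))"
      by (intro continuous_intros continuous_on_compose2[OF wx_cont]) (auto simp: r0 r1)
    then show ?thesis
      by (simp add: case_prod_unfold)
  qed
  moreover have "continuous_on {(y, t). 0 < t \<and> t \<le> \<sigma> \<and> r0 t < y \<and> y < r1 t}
      (\<lambda>(y, t). wxx (y + c * t) t)"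
  proof -
    have "continuous_on {(y, t). 0 < t \<and> t \<le> \<sigma> \<and> r0 t < y \<and> y < r1 t}
        (\<lambda>p. (\<lambda>(x, t). wxx x t) (fst p + c * snd p, snd p))"
      by (intro continuous_intros continuous_on_compose2[OF wxx_cont]) (auto simp: r0 r1)
    then show ?thesis
      by (simp add: case_prod_unfold)
  qed
  moreover have "continuous_on {(y, t). 0 < t \<and> t \<le> \<sigma> \<and> r0 t < y \<and> y < r1 t}
      (\<lambda>(y, t). wt (y + c * t) t + c * wx (y + c * t) t)"
  proof -
    have "continuous_on {(y, t). 0 < t \<and> t \<le> \<sigma> \<and> r0 t < y \<and> y < r1 t}
        (\<lambda>p. (\<lambda>(x, t). wt x t) (fst p + c * snd p, snd p)
          + c * (\<lambda>(y, t). wx (y + c * t) t) p)"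
      by (intro continuous_intros continuous_on_compose2[OF wt_cont]
          continuous_on_subset[OF wx_frame]) (auto simp: r0 r1)
    then show ?thesis
      by (simp add: case_prod_unfold)
  qed
  moreover have "((\<lambda>\<xi>. u \<xi> t) has_real_derivative wx (y + c * t) t) (at y within {r0 t..r1 t})"
    if t: "t \<in> {0<..\<sigma>}" and y: "y \<in> {r0 t..r1 t}" for t y
  proof -
    have r_eq: "r0 t = s0 t - c * t" "r1 t = s1 t - c * t"
      using r0 r1 t by auto
    have image: "(\<lambda>\<xi>. \<xi> + c * t) ` {r0 t..r1 t} = {s0 t..s1 t}"
      by (simp add: r_eq)
    have "((\<lambda>\<xi>. w \<xi> t) has_real_derivative wx (y + c * t) t)
        (at (y + c * t) within (\<lambda>\<xi>. \<xi> + c * t) ` {r0 t..r1 t})"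
      unfolding image using t y by (intro wx) (auto simp: r_eq)
    moreover have "((\<lambda>\<xi>. \<xi> + c * t) has_real_derivative 1) (at y within {r0 t..r1 t})"
      by (auto intro!: derivative_eq_intros)
    ultimately have "((\<lambda>\<xi>. w (\<xi> + c * t) t) has_real_derivative wx (y + c * t) t)
        (at y within {r0 t..r1 t})"
      using DERIV_image_chain by (fastforce simp: o_def)
    then have "((\<lambda>\<xi>. w (\<xi> + c * t) t - k) has_real_derivative wx (y + c * t) t)
        (at y within {r0 t..r1 t})"
      by (auto intro!: derivative_eq_intros)
    then show ?thesis
      by (rule has_field_derivative_transform_within[OF _ zero_less_one]) (use t y u in auto)
  qed
  moreover have "((\<lambda>\<xi>. wx (\<xi> + c * t) t) has_real_derivative wxx (y + c * t) t) (at y)"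
    if "t \<in> {0<..\<sigma>}" "y \<in> {r0 t<..<r1 t}" for t y
  proof -
    have "((\<lambda>\<xi>. wx \<xi> t) has_real_derivative wxx (y + c * t) t) (at (y + c * t))"
      using that by (intro wxx) (auto simp: r0 r1)
    then show ?thesis
      by (simp add: DERIV_shift)
  qed
  moreover have "((\<lambda>\<tau>. u y \<tau>) has_real_derivative wt (y + c * t) t + c * wx (y + c * t) t)
      (at t within {\<tau>\<in>{0..\<sigma>}. r0 \<tau> \<le> y \<and> y \<le> r1 \<tau>})"
    if t: "t \<in> {0<..\<sigma>}" and y: "y \<in> {r0 t<..<r1 t}" for t y
  proof -
    have yr: "r0 t < y" "y < r1 t" and ys: "s0 t < y + c * t" "y + c * t < s1 t"
      and t': "0 < t" "t \<le> \<sigma>"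
      using t y by (auto simp: r0 r1)
    have "((\<lambda>\<tau>. w (y + c * t) \<tau>) has_real_derivative wt (y + c * t) t) (at t within {0..\<sigma>})"
      using wt[OF t, of "y + c * t"] at_within_moving_domain_times[OF s t' ys] ys by simp
    then have "((\<lambda>\<tau>. w (y + c * \<tau>) \<tau>) has_real_derivative wt (y + c * t) t + c * wx (y + c * t) t)
        (at t within {0..\<sigma>})"
      using has_real_derivative_along_slanted_line[OF s wx_cont _ t' ys, of w] wx by blast
    then have "((\<lambda>\<tau>. w (y + c * \<tau>) \<tau> - k) has_real_derivative
        wt (y + c * t) t + c * wx (y + c * t) t)
        (at t within {\<tau>\<in>{0..\<sigma>}. r0 \<tau> \<le> y \<and> y \<le> r1 \<tau>})"
      unfolding at_within_moving_domain_times[OF r t' yr]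
      by (auto intro!: derivative_eq_intros)
    then show ?thesis
      by (rule has_field_derivative_transform_within[OF _ zero_less_one]) (use t' yr u in auto)
  qed
  moreover have "(\<lambda>\<tau>. wx (r0 \<tau> + c * \<tau>) \<tau>) integrable_on {0..\<sigma>}"
    using int0 by (rule integrable_eq) (simp add: r0)
  moreover have "(\<lambda>\<tau>. wx (r1 \<tau> + c * \<tau>) \<tau>) integrable_on {0..\<sigma>}"
    using int1 by (rule integrable_eq) (simp add: r1)
  ultimately show ?thesis
    using r unfolding classical_regularity_def by blast
qed

section \<open>Equivalence of the two free boundary problems\<close>

text \<open>
  The flux condition at the right boundary, where \<open>v = \<beta>\<close>, with \<open>p\<close> the space derivative there
  and \<open>d\<close> the boundary speed in the resting frame.
\<close>

lemma flux_condition_moving_frame: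
  fixes D \<beta> p d :: real
  assumes "\<beta> > 0"
  shows "D * (p / \<beta>) - \<beta> = - (\<beta> / (\<beta> + 1)) * d \<longleftrightarrow>
    D * (p / \<beta>) = (\<beta> * (1 - \<beta>) - \<beta> * (d - 2 * \<beta>)) / (\<beta> + 1)"
proof -
  have "(\<beta> * (1 - \<beta>) - \<beta> * (d - 2 * \<beta>)) / (\<beta> + 1) = \<beta> - \<beta> / (\<beta> + 1) * d"
    using assms by (simp add: field_simps)
  then show ?thesis
    by auto
qed

theorem lemma2p3:
  fixes D \<beta> b \<sigma> C1 C2 U0 :: real
    and f u0 g v0 V0 z0 z1 y0 y1 :: "real \<Rightarrow> real"
    and v V :: "real \<Rightarrow> real \<Rightarrow> real"
  assumes "D > 0" and "\<beta> > 0" and "b > 0" and "\<sigma> > 0"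
    and "C1_on {0..\<sigma>} f" and "C1_on {0..b} u0"
    and "u0 0 = f 0" and "u0 b = \<beta>"
    and "\<And>x. 0 \<le> x \<Longrightarrow> x < b \<Longrightarrow> u0 x > \<beta>"
    and "\<And>t. t \<in> {0..\<sigma>} \<Longrightarrow> f t > 3 * \<beta> / 2"
    and "U0 = integral {0..b} (\<lambda>\<eta>. 1 / u0 \<eta>)"
    and "C2 = C1 + U0"
    and "\<And>x. x \<in> {0..b} \<Longrightarrow> g x = C1 + integral {0..x} (\<lambda>\<eta>. 1 / u0 \<eta>)"
    and "\<And>z. z \<in> {C1..C2} \<Longrightarrow> v0 z = u0 (the_inv_into {0..b} g z)"
    and "\<And>y. y \<in> {C1..C2} \<Longrightarrow> V0 y = v0 y - \<beta>"
    and "\<And>t. t \<in> {0..\<sigma>} \<Longrightarrow> y0 t = z0 t - 2 * \<beta> * t"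
    and "\<And>t. t \<in> {0..\<sigma>} \<Longrightarrow> y1 t = z1 t - 2 * \<beta> * t"
    and "\<And>z y t. t \<in> {0..\<sigma>} \<Longrightarrow> z \<in> {z0 t..z1 t} \<Longrightarrow> y = z - 2 * \<beta> * t \<Longrightarrow> V y t = v z t - \<beta>"
  shows "solves_fbp_v D \<beta> \<sigma> f C1 C2 v0 v z0 z1 \<longleftrightarrow> solves_fbp_V D \<beta> \<sigma> f C1 C2 V0 V y0 y1"
proof -
  note pos = \<open>\<beta> > 0\<close>
  note V0 = assms(15) and y0 = assms(16) and y1 = assms(17) and V = assms(18)
  have V': "V y t = v (y + 2 * \<beta> * t) t - \<beta>" if "t \<in> {0..\<sigma>}" "y \<in> {y0 t..y1 t}" for y t
    using that by (intro V) (auto simp: y0 y1)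
  show ?thesis
  proof
    assume "solves_fbp_v D \<beta> \<sigma> f C1 C2 v0 v z0 z1"
    then obtain dz1 vz vzz vt where
      reg: "classical_regularity \<sigma> z0 z1 dz1 v vz vzz vt"
      and pde: "\<And>t z. t \<in> {0<..\<sigma>} \<Longrightarrow> z \<in> {z0 t<..<z1 t} \<Longrightarrow>
        vt z t = D * vzz z t - 2 * v z t * vz z t"
      and left: "\<And>t. t \<in> {0<..\<sigma>} \<Longrightarrow> v (z0 t) t = f t"
      and right: "\<And>t. t \<in> {0<..\<sigma>} \<Longrightarrow> v (z1 t) t = \<beta>"
      and flux: "\<And>t. t \<in> {0<..\<sigma>} \<Longrightarrow>
        D * (vz (z1 t) t / v (z1 t) t) - v (z1 t) t = - (\<beta> / (\<beta> + 1)) * dz1 t"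
      and init: "\<And>z. z \<in> {C1..C2} \<Longrightarrow> v z 0 = v0 z" "z0 0 = C1" "z1 0 = C2"
      and z0: "\<And>t. t \<in> {0..\<sigma>} \<Longrightarrow>
        z0 t = C1 + integral {0..t} (\<lambda>\<tau>. f \<tau> - D * (vz (z0 \<tau>) \<tau> / f \<tau>))"
      and z1: "\<And>t. t \<in> {0..\<sigma>} \<Longrightarrow> z1 t = C2 + (\<beta> + 1) * t
        - D * (\<beta> + 1) / \<beta>\<^sup>2 * integral {0..t} (\<lambda>\<tau>. vz (z1 \<tau>) \<tau>)"
      unfolding solves_fbp_v_def by blast
    have less: "z0 t < z1 t" if "t \<in> {0..\<sigma>}" for t
      using reg that unfolding classical_regularity_def by blast
    define Vy where "Vy = (\<lambda>y t. vz (y + 2 * \<beta> * t) t)"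
    define Vyy where "Vyy = (\<lambda>y t. vzz (y + 2 * \<beta> * t) t)"
    define Vt where "Vt = (\<lambda>y t. vt (y + 2 * \<beta> * t) t + 2 * \<beta> * vz (y + 2 * \<beta> * t) t)"
    have "classical_regularity \<sigma> y0 y1 (\<lambda>t. dz1 t - 2 * \<beta>) V Vy Vyy Vt"
      unfolding Vy_def Vyy_def Vt_def
      by (rule classical_regularity_moving_frame[OF reg y0 y1 V'])
    moreover have "Vt y t = D * Vyy y t - 2 * V y t * Vy y t"
      if "t \<in> {0<..\<sigma>}" "y \<in> {y0 t<..<y1 t}" for t y
    proof -
      have "vt (y + 2 * \<beta> * t) t = D * Vyy y t - 2 * v (y + 2 * \<beta> * t) t * Vy y t"
        unfolding Vy_def Vyy_def using that by (intro pde) (auto simp: y0 y1)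
      moreover have "v (y + 2 * \<beta> * t) t = V y t + \<beta>"
        using that by (simp add: V')
      ultimately show ?thesis
        by (simp add: Vt_def Vy_def ring_distribs)
    qed
    moreover have "V (y0 t) t = f t - \<beta>" "V (y1 t) t = 0" if "t \<in> {0<..\<sigma>}" for t
      using that V[of t "z0 t" "y0 t"] V[of t "z1 t" "y1 t"] less[of t] left right
      by (auto simp: y0 y1)
    moreover have "D * (Vy (y1 t) t / \<beta>) = (\<beta> * (1 - \<beta>) - \<beta> * (dz1 t - 2 * \<beta>)) / (\<beta> + 1)"
      if "t \<in> {0<..\<sigma>}" for t
      using flux[OF that] right[OF that] that
      unfolding flux_condition_moving_frame[OF pos, symmetric] by (simp add: Vy_def y1)
    moreover have "V y 0 = V0 y" if "y \<in> {C1..C2}" for y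
      using that V[of 0 y y] init V0 \<open>\<sigma> > 0\<close> by auto
    moreover have "y0 0 = C1" "y1 0 = C2"
      using init y0[of 0] y1[of 0] \<open>\<sigma> > 0\<close> by auto
    moreover have "y0 t = C1 - 2 * \<beta> * t
        + integral {0..t} (\<lambda>\<tau>. f \<tau> - D * (Vy (y0 \<tau>) \<tau> / f \<tau>))" if "t \<in> {0..\<sigma>}" for t
    proof -
      have "integral {0..t} (\<lambda>\<tau>. f \<tau> - D * (Vy (y0 \<tau>) \<tau> / f \<tau>))
          = integral {0..t} (\<lambda>\<tau>. f \<tau> - D * (vz (z0 \<tau>) \<tau> / f \<tau>))"
        using that by (intro integral_cong) (auto simp: Vy_def y0)
      then show ?thesis
        using z0[OF that] y0[OF that] by simp
    qed
    moreover have "y1 t = C2 + (1 - \<beta>) * t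
        - D * (\<beta> + 1) / \<beta>\<^sup>2 * integral {0..t} (\<lambda>\<tau>. Vy (y1 \<tau>) \<tau>)" if "t \<in> {0..\<sigma>}" for t
    proof -
      have "integral {0..t} (\<lambda>\<tau>. Vy (y1 \<tau>) \<tau>) = integral {0..t} (\<lambda>\<tau>. vz (z1 \<tau>) \<tau>)"
        using that by (intro integral_cong) (auto simp: Vy_def y1)
      then show ?thesis
        using z1[OF that] y1[OF that] by (simp add: algebra_simps)
    qed
    ultimately show "solves_fbp_V D \<beta> \<sigma> f C1 C2 V0 V y0 y1"
      unfolding solves_fbp_V_def by blast
  next
    assume "solves_fbp_V D \<beta> \<sigma> f C1 C2 V0 V y0 y1"
    then obtain dy1 Vy Vyy Vt where
      reg: "classical_regularity \<sigma> y0 y1 dy1 V Vy Vyy Vt"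
      and pde: "\<And>t y. t \<in> {0<..\<sigma>} \<Longrightarrow> y \<in> {y0 t<..<y1 t} \<Longrightarrow>
        Vt y t = D * Vyy y t - 2 * V y t * Vy y t"
      and left: "\<And>t. t \<in> {0<..\<sigma>} \<Longrightarrow> V (y0 t) t = f t - \<beta>"
      and right: "\<And>t. t \<in> {0<..\<sigma>} \<Longrightarrow> V (y1 t) t = 0"
      and flux: "\<And>t. t \<in> {0<..\<sigma>} \<Longrightarrow>
        D * (Vy (y1 t) t / \<beta>) = (\<beta> * (1 - \<beta>) - \<beta> * dy1 t) / (\<beta> + 1)"
      and init: "\<And>y. y \<in> {C1..C2} \<Longrightarrow> V y 0 = V0 y" "y0 0 = C1" "y1 0 = C2"
      and y0_int: "\<And>t. t \<in> {0..\<sigma>} \<Longrightarrow> y0 t = C1 - 2 * \<beta> * t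
        + integral {0..t} (\<lambda>\<tau>. f \<tau> - D * (Vy (y0 \<tau>) \<tau> / f \<tau>))"
      and y1_int: "\<And>t. t \<in> {0..\<sigma>} \<Longrightarrow> y1 t = C2 + (1 - \<beta>) * t
        - D * (\<beta> + 1) / \<beta>\<^sup>2 * integral {0..t} (\<lambda>\<tau>. Vy (y1 \<tau>) \<tau>)"
      unfolding solves_fbp_V_def by blast
    have less: "z0 t < z1 t" if "t \<in> {0..\<sigma>}" for t
    proof -
      have "y0 t < y1 t"
        using reg that unfolding classical_regularity_def by blast
      then show ?thesis
        using that by (simp add: y0 y1)
    qed
    define vz where "vz = (\<lambda>z t. Vy (z + - (2 * \<beta>) * t) t)"
    define vzz where "vzz = (\<lambda>z t. Vyy (z + - (2 * \<beta>) * t) t)"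
    define vt where
      "vt = (\<lambda>z t. Vt (z + - (2 * \<beta>) * t) t + - (2 * \<beta>) * Vy (z + - (2 * \<beta>) * t) t)"
    have "classical_regularity \<sigma> z0 z1 (\<lambda>t. dy1 t - - (2 * \<beta>)) v vz vzz vt"
      unfolding vz_def vzz_def vt_def
    proof (rule classical_regularity_moving_frame[OF reg])
      show "v z t = V (z + - (2 * \<beta>) * t) t - - \<beta>"
        if "t \<in> {0..\<sigma>}" "z \<in> {z0 t..z1 t}" for z t
        using V[OF that] by simp
    qed (simp_all add: y0 y1)
    moreover have "vt z t = D * vzz z t - 2 * v z t * vz z t"
      if "t \<in> {0<..\<sigma>}" "z \<in> {z0 t<..<z1 t}" for t z
    proof -
      have "Vt (z + - (2 * \<beta>) * t) t
          = D * vzz z t - 2 * V (z + - (2 * \<beta>) * t) t * vz z t"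
        unfolding vz_def vzz_def using that by (intro pde) (auto simp: y0 y1)
      moreover have "V (z + - (2 * \<beta>) * t) t = v z t - \<beta>"
        using that by (intro V) auto
      moreover have "vt z t = Vt (z + - (2 * \<beta>) * t) t - 2 * \<beta> * vz z t"
        by (simp add: vt_def vz_def)
      ultimately show ?thesis
        by algebra
    qed
    moreover have "v (z0 t) t = f t" and v_right: "v (z1 t) t = \<beta>" if "t \<in> {0<..\<sigma>}" for t
      using that V[of t "z0 t" "y0 t"] V[of t "z1 t" "y1 t"] less[of t] left[of t] right[of t]
      by (auto simp: y0 y1)
    moreover have "D * (vz (z1 t) t / v (z1 t) t) - v (z1 t) t
        = - (\<beta> / (\<beta> + 1)) * (dy1 t - - (2 * \<beta>))"
      if "t \<in> {0<..\<sigma>}" for t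
      unfolding v_right[OF that] flux_condition_moving_frame[OF pos]
      using flux[OF that] that by (simp add: vz_def y1)
    moreover have "v z 0 = v0 z" if "z \<in> {C1..C2}" for z
      using that V[of 0 z z] init V0[of z] y0[of 0] y1[of 0] \<open>\<sigma> > 0\<close> by auto
    moreover have "z0 0 = C1" "z1 0 = C2"
      using init y0[of 0] y1[of 0] \<open>\<sigma> > 0\<close> by auto
    moreover have "z0 t = C1 + integral {0..t} (\<lambda>\<tau>. f \<tau> - D * (vz (z0 \<tau>) \<tau> / f \<tau>))"
      if "t \<in> {0..\<sigma>}" for t
    proof -
      have "integral {0..t} (\<lambda>\<tau>. f \<tau> - D * (vz (z0 \<tau>) \<tau> / f \<tau>))
          = integral {0..t} (\<lambda>\<tau>. f \<tau> - D * (Vy (y0 \<tau>) \<tau> / f \<tau>))"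
        using that by (intro integral_cong) (auto simp: vz_def y0)
      then show ?thesis
        using y0_int[OF that] y0[OF that] by simp
    qed
    moreover have "z1 t = C2 + (\<beta> + 1) * t
        - D * (\<beta> + 1) / \<beta>\<^sup>2 * integral {0..t} (\<lambda>\<tau>. vz (z1 \<tau>) \<tau>)" if "t \<in> {0..\<sigma>}" for t
    proof -
      have "integral {0..t} (\<lambda>\<tau>. vz (z1 \<tau>) \<tau>) = integral {0..t} (\<lambda>\<tau>. Vy (y1 \<tau>) \<tau>)"
        using that by (intro integral_cong) (auto simp: vz_def y1)
      then show ?thesis
        using y1_int[OF that] y1[OF that] by (simp add: algebra_simps)
    qed
    ultimately show "solves_fbp_v D \<beta> \<sigma> f C1 C2 v0 v z0 z1"
      unfolding solves_fbp_v_def by blast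
  qed
qed

end
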